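(* If $X\in L$, then $f_X(0)\ge\frac1{72}$.
   Context: $L$ denotes the set of all real-valued random variables $X$ that have a log-concave probability density function $f_X$ on $\mathbb{R}$ (that is, $f_X((1-t)x+ty)\ge f_X(x)^{1-t}f_X(y)^t$ for all real $x,y$ and all $t\in(0,1)$) and satisfy $EX=0$ and $EX^2=1$. Here $f_X$ denotes this log-concave density. *)

theory Defs
  imports "HOL-Probability.Probability"
begin

(* As 0 powr a = 0, the inequality is the usual one also where f vanishes.
   Non-negativity is explicit because powr is only meaningful for non-negative bases. *)
definition log_concave_function :: "(real \<Rightarrow> real) \<Rightarrow> bool" where
  "log_concave_function f \<longleftrightarrow>
     (\<forall>x. 0 \<le> f x) \<and>
     (\<forall>x y. \<forall>t\<in>{0<..<1}.
        f ((1 - t) * x + t * y) \<ge> f x powr (1 - t) * f y powr t)"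

definition log_concave_density :: "'a measure \<Rightarrow> ('a \<Rightarrow> real) \<Rightarrow> (real \<Rightarrow> real) \<Rightarrow> bool" where
  "log_concave_density M X f \<longleftrightarrow>
     distributed M lborel X (\<lambda>x. ennreal (f x)) \<and> log_concave_function f"

(* The integrability conditions say that the two moments exist; without them the
   Bochner integral would be 0 by convention. *)
definition class_L :: "'a measure \<Rightarrow> ('a \<Rightarrow> real) set" where
  "class_L M = {X. (\<exists>f. log_concave_density M X f) \<and>
     integrable M X \<and> (\<integral>\<omega>. X \<omega> \<partial>M) = 0 \<and>
     integrable M (\<lambda>\<omega>. (X \<omega>)\<^sup>2) \<and> (\<integral>\<omega>. (X \<omega>)\<^sup>2 \<partial>M) = 1}"

end

theory Submission
  imports Defs "HOL-Real_Asymp.Real_Asymp"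
begin

text \<open>
  Write \<open>a = f 0\<close>. A log-concave function lies below an exponential tangent to it at any interior
  point of its support, so \<open>f x \<le> a * exp (c * x)\<close> for some slope \<open>c\<close>
  (\<open>log_concave_tangent_at_0\<close>); the origin is interior because a centred, non-degenerate density
  charges both half-lines. Reflecting \<open>X\<close> if necessary, take \<open>c = - l\<close> with \<open>l \<ge> 0\<close>.

  The tangent bounds the mass of \<open>{-K..K}\<close> by \<open>2 * K * a * exp (l * K)\<close>, while Markov's inequality
  bounds the mass outside by \<open>E \<bar>X\<bar>^p / K^p\<close>. Since the two masses add up to \<open>1\<close>, the number \<open>a\<close>
  cannot be too small as soon as \<open>l * K\<close> stays bounded and the Markov term is well below \<open>1\<close>
  (\<open>mass_le_window_plus_moment\<close>). There are two regimes.

  \<^item> For a gentle slope, \<open>l < 1\<close>, the unit variance suffices: \<open>p = 2\<close> and \<open>K = 2\<close> give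
    \<open>1 \<le> 4 * a * exp 2 + 1/4\<close>.
  \<^item> For a steep slope, \<open>l \<ge> 1\<close>, the window must shrink to \<open>K = 1 / l\<close>, and the variance
    says too little at this scale. But the positive part of \<open>X\<close> is then dominated by an exponential
    tail, whence \<open>E X\<^sup>+ \<le> a / l\<^sup>2\<close>, and centring turns this one-sided bound into
    \<open>E \<bar>X\<bar> = 2 * E X\<^sup>+ \<le> 2 * a / l\<^sup>2\<close>. With \<open>p = 1\<close> this gives \<open>1 \<le> (2 * exp 1 + 2) * a / l\<close>.

  With \<open>exp 1 \<le> 3\<close> both cases give at least \<open>a \<ge> 1/48\<close>.
\<close>

section \<open>Centred densities of unit variance\<close>

definition standardized_density :: "(real \<Rightarrow> real) \<Rightarrow> bool" where
  "standardized_density f \<longleftrightarrow>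
     (\<forall>x. 0 \<le> f x) \<and>
     has_bochner_integral lborel f 1 \<and>
     has_bochner_integral lborel (\<lambda>x. x * f x) 0 \<and>
     has_bochner_integral lborel (\<lambda>x. x\<^sup>2 * f x) 1"

lemma standardized_density_reflect:
  assumes "standardized_density f"
  shows "standardized_density (\<lambda>x. f (- x))"
proof -
  have refl: "has_bochner_integral lborel (\<lambda>x. h (- x)) I"
    if "has_bochner_integral lborel h I" for h :: "real \<Rightarrow> real" and I
    using lborel_has_bochner_integral_real_affine_iff[of "-1" h I 0] that by simp
  have "has_bochner_integral lborel (\<lambda>x. - x * f (- x)) 0"
    using assms refl[of "\<lambda>x. x * f x" 0] by (simp add: standardized_density_def)
  then have "has_bochner_integral lborel (\<lambda>x. x * f (- x)) 0"
    using has_bochner_integral_minus[of lborel "\<lambda>x. - x * f (- x)" 0] by simp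
  then show ?thesis
    using assms refl[of f 1] refl[of "\<lambda>x. x\<^sup>2 * f x" 1]
    by (simp add: standardized_density_def)
qed

text \<open>A density vanishing on the right half-line has non-positive first-moment integrand, so mean
  zero would make \<open>x * f x\<close>, and with it \<open>x\<^sup>2 * f x\<close>, vanish almost everywhere.\<close>

lemma standardized_density_charges_right:
  assumes "standardized_density f"
  shows "\<exists>x>0. 0 < f x"
proof (rule ccontr)
  assume "\<not> (\<exists>x>0. 0 < f x)"
  moreover have "0 \<le> f x" for x
    using assms by (simp add: standardized_density_def)
  ultimately have zero: "f x = 0" if "x > 0" for x
    using that by (meson linorder_not_less order.antisym)
  have nonneg: "0 \<le> - (x * f x)" for x
    using assms zero[of x]
    by (cases "x > 0") (auto simp: standardized_density_def mult_nonpos_nonneg)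
  have "has_bochner_integral lborel (\<lambda>x. - (x * f x)) 0"
    using assms has_bochner_integral_minus[of lborel "\<lambda>x. x * f x" 0]
    by (simp add: standardized_density_def)
  then have "AE x in lborel. - (x * f x) = 0"
    using integral_nonneg_eq_0_iff_AE[of lborel "\<lambda>x. - (x * f x)"] nonneg
    by (simp add: has_bochner_integral_iff)
  then have "AE x in lborel. x\<^sup>2 * f x = 0"
    by eventually_elim (simp add: power2_eq_square)
  then have "(\<integral>x. x\<^sup>2 * f x \<partial>lborel) = 0"
    by (rule integral_eq_zero_AE)
  with assms show False
    by (simp add: standardized_density_def has_bochner_integral_iff)
qed

lemma standardized_density_charges_left:
  assumes "standardized_density f"
  shows "\<exists>x<0. 0 < f x"
  using standardized_density_charges_right[OF standardized_density_reflect[OF assms]]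
  by (metis neg_less_0_iff_less)

section \<open>Tangents of log-concave functions\<close>

text \<open>Concavity of \<open>ln \<circ> f\<close> at \<open>0 = (1 - t) * u + t * v\<close>: difference quotients from the
  origin decrease from left to right.\<close>

lemma log_concave_three_points:
  assumes "log_concave_function f" "u < 0" "0 < v" "0 < f u" "0 < f v"
  shows "0 < f 0" and "ln (f v / f 0) / v \<le> ln (f u / f 0) / u"
proof -
  define t where "t = - u / (v - u)"
  have t: "t \<in> {0<..<1}" "(1 - t) * u + t * v = 0"
    using assms(2,3) by (auto simp: t_def field_simps)
  have ge: "f 0 \<ge> f u powr (1 - t) * f v powr t"
    using assms(1) t unfolding log_concave_function_def by metis
  moreover have pos: "0 < f u powr (1 - t) * f v powr t"
    using assms(4,5) by simp
  ultimately show f0: "0 < f 0" by linarith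
  have "ln (f u powr (1 - t) * f v powr t) \<le> ln (f 0)"
    using ge pos f0 by simp
  then have "(1 - t) * ln (f u) + t * ln (f v) \<le> ln (f 0)"
    using assms(4,5) by (simp add: ln_mult ln_powr)
  moreover have "1 - t = v / (v - u)"
    using assms(2,3) by (simp add: t_def field_simps)
  ultimately have "(v * ln (f u) - u * ln (f v)) / (v - u) \<le> ln (f 0)"
    by (simp add: t_def diff_divide_distrib)
  then have "v * ln (f u) - u * ln (f v) \<le> ln (f 0) * (v - u)"
    using assms(2,3) by (simp add: pos_divide_le_eq)
  then have "v * (ln (f u) - ln (f 0)) \<le> u * (ln (f v) - ln (f 0))"
    by (simp add: algebra_simps)
  then show "ln (f v / f 0) / v \<le> ln (f u / f 0) / u"
    using assms(2-5) f0 by (simp add: ln_div field_simps)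
qed

text \<open>The slope is the supremum of the difference quotients of \<open>ln \<circ> f\<close> between \<open>0\<close> and points to
  its right; quotients to the left are upper bounds by concavity. Positivity of \<open>f\<close> somewhere on
  either side makes the set non-empty and the supremum finite.\<close>

lemma log_concave_tangent_at_0:
  assumes "log_concave_function f" "u < 0" "0 < f u" "0 < v" "0 < f v"
  shows "\<exists>c. \<forall>x. f x \<le> f 0 * exp (c * x)"
proof -
  have f0: "0 < f 0"
    using log_concave_three_points(1) assms by blast
  define S where "S = {ln (f x / f 0) / x | x. 0 < x \<and> 0 < f x}"
  have "S \<noteq> {}"
    using assms by (auto simp: S_def)
  have ub: "s \<le> ln (f y / f 0) / y" if "s \<in> S" "y < 0" "0 < f y" for s y
    using that log_concave_three_points(2)[OF assms(1)] by (auto simp: S_def)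
  then have "bdd_above S"
    using assms by (meson bdd_above.I)
  have "f x \<le> f 0 * exp (Sup S * x)" for x
  proof (cases "x = 0 \<or> f x = 0")
    case True
    then show ?thesis using f0 by auto
  next
    case False
    then have fx: "0 < f x"
      using assms(1) by (metis log_concave_function_def order_le_less)
    have "ln (f x / f 0) \<le> Sup S * x"
    proof (cases "0 < x")
      case True
      then have "ln (f x / f 0) / x \<le> Sup S"
        using fx \<open>bdd_above S\<close> by (intro cSup_upper) (auto simp: S_def)
      then show ?thesis
        using True by (simp add: field_simps)
    next
      case x: False
      then have "Sup S \<le> ln (f x / f 0) / x"
        using False fx ub by (intro cSup_least \<open>S \<noteq> {}\<close>) auto
      then show ?thesis
        using x False by (simp add: field_simps)
    qed
    then have "f x / f 0 \<le> exp (Sup S * x)"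
      using fx f0 by (metis divide_pos_pos exp_le_cancel_iff exp_ln)
    then show ?thesis
      using f0 by (simp add: field_simps)
  qed
  then show ?thesis by blast
qed

section \<open>Moment bounds\<close>

lemma has_bochner_integral_mono:
  fixes f g :: "'a \<Rightarrow> real"
  assumes "has_bochner_integral M f I" "has_bochner_integral M g J" "\<And>x. f x \<le> g x"
  shows "I \<le> J"
  using assms integral_mono[of M f g] by (simp add: has_bochner_integral_iff)

text \<open>Markov's inequality for the complement of \<open>{-K..K}\<close>, with the mass of the window itself
  bounded by its length times a bound on the density.\<close>

lemma mass_le_window_plus_moment:
  fixes f :: "real \<Rightarrow> real"
  assumes nonneg: "\<And>x. 0 \<le> f x"
    and mass: "has_bochner_integral lborel f m"
    and moment: "has_bochner_integral lborel (\<lambda>x. \<bar>x\<bar> ^ p * f x) I"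
    and K: "0 < K"
    and bound: "\<And>x. \<bar>x\<bar> \<le> K \<Longrightarrow> f x \<le> C"
  shows "m \<le> 2 * K * C + I / K ^ p"
proof -
  have "has_bochner_integral lborel (\<lambda>x. indicator {- K..K} x * C) (measure lborel {- K..K} * C)"
    using K by (intro has_bochner_integral_mult_left has_bochner_integral_real_indicator) auto
  then have "has_bochner_integral lborel (\<lambda>x. indicator {- K..K} x * C + \<bar>x\<bar> ^ p * f x / K ^ p)
      (2 * K * C + I / K ^ p)"
    using K moment by (intro has_bochner_integral_add has_bochner_integral_divide_zero) auto
  moreover have "f x \<le> indicator {- K..K} x * C + \<bar>x\<bar> ^ p * f x / K ^ p" for x
  proof (cases "\<bar>x\<bar> \<le> K")
    case True
    have "0 \<le> \<bar>x\<bar> ^ p * f x / K ^ p"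
      using K nonneg by simp
    then show ?thesis
      using True bound[OF True] by (simp add: indicator_def abs_le_iff)
  next
    case False
    then have "K ^ p * f x \<le> \<bar>x\<bar> ^ p * f x"
      using K nonneg by (intro mult_right_mono power_mono) auto
    then show ?thesis
      using False K by (auto simp: indicator_def field_simps)
  qed
  ultimately show ?thesis
    by (rule has_bochner_integral_mono[OF mass])
qed

lemma has_bochner_integral_exponential_first_moment:
  fixes l :: real
  assumes "0 < l"
  shows "has_bochner_integral lborel (\<lambda>x. x * exp (- l * x) * indicator {0..} x) (1 / l\<^sup>2)"
proof -
  define F where "F = (\<lambda>x::real. - (x / l + 1 / l\<^sup>2) * exp (- l * x))"
  have "(F has_real_derivative x * exp (- l * x)) (at x)" for x
    unfolding F_def using assms
    by (auto intro!: derivative_eq_intros simp: field_simps power2_eq_square)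
  moreover have "(F \<longlongrightarrow> 0) at_top"
    unfolding F_def using assms by real_asymp
  ultimately have "(\<integral>\<^sup>+x. ennreal (x * exp (- l * x)) * indicator {0..} x \<partial>lborel)
      = ennreal (0 - F 0)"
    by (intro nn_integral_FTC_atLeast) auto
  moreover have "ennreal (x * exp (- l * x)) * indicator {0..} x
      = ennreal (x * exp (- l * x) * indicator {0..} x)" for x
    by (simp add: indicator_def)
  ultimately have "(\<integral>\<^sup>+x. ennreal (x * exp (- l * x) * indicator {0..} x) \<partial>lborel)
      = ennreal (1 / l\<^sup>2)"
    by (simp add: F_def)
  then show ?thesis
    by (intro has_bochner_integral_nn_integral) (auto simp: indicator_def)
qed

text \<open>The factor \<open>2\<close> is where centring enters: \<open>\<bar>x\<bar> = 2 * max 0 x - x\<close>, and the last term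
  integrates to \<open>0\<close>.\<close>

lemma abs_moment_le_of_exponential_tail:
  assumes f: "standardized_density f"
    and l: "0 < l"
    and tail: "\<And>x. f x \<le> a * exp (- l * x)"
  shows "\<exists>I. has_bochner_integral lborel (\<lambda>x. \<bar>x\<bar> * f x) I \<and> I \<le> 2 * a / l\<^sup>2"
proof -
  have mean: "has_bochner_integral lborel (\<lambda>x. x * f x) 0" and nonneg: "\<And>x. 0 \<le> f x"
    using f by (auto simp: standardized_density_def)
  have "has_bochner_integral lborel (\<lambda>x. \<bar>x * f x\<bar>) (\<integral>x. \<bar>x * f x\<bar> \<partial>lborel)"
    using mean by (intro has_bochner_integral_integrable integrable_abs)
      (simp add: has_bochner_integral_iff)
  then obtain I where I: "has_bochner_integral lborel (\<lambda>x. \<bar>x\<bar> * f x) I"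
    using nonneg by (auto simp: abs_mult)
  have "has_bochner_integral lborel (\<lambda>x. \<bar>x\<bar> * f x + x * f x) (I + 0)"
    by (intro has_bochner_integral_add I mean)
  moreover have "has_bochner_integral lborel
      (\<lambda>x. 2 * a * (x * exp (- l * x) * indicator {0..} x)) (2 * a * (1 / l\<^sup>2))"
    by (intro has_bochner_integral_mult_right has_bochner_integral_exponential_first_moment l)
  moreover have "\<bar>x\<bar> * f x + x * f x \<le> 2 * a * (x * exp (- l * x) * indicator {0..} x)" for x
    using mult_left_mono[OF tail[of x], of "2 * x"]
    by (cases "0 \<le> x") (auto simp: indicator_def algebra_simps)
  ultimately have "I + 0 \<le> 2 * a * (1 / l\<^sup>2)"
    by (rule has_bochner_integral_mono)
  with I show ?thesis by auto
qed

section \<open>The density at the mean\<close>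

text \<open>The two regimes of the slope: at \<open>l = 1\<close> the argument switches from the second moment and a
  fixed window to the first absolute moment and a window of width proportional to \<open>1 / l\<close>.\<close>

lemma standardized_density_exponential_bound:
  assumes f: "standardized_density f"
    and l: "0 \<le> l"
    and tangent: "\<And>x. f x \<le> a * exp (- l * x)"
  shows "1 / 72 \<le> a"
proof -
  have nonneg: "\<And>x. 0 \<le> f x" and mass: "has_bochner_integral lborel f 1"
    using f by (auto simp: standardized_density_def)
  have a: "0 \<le> a"
    using nonneg[of 0] tangent[of 0] by simp
  have window: "f x \<le> a * exp (l * K)" if "\<bar>x\<bar> \<le> K" for x K
  proof -
    have "- x * l \<le> K * l"
      using that l by (intro mult_right_mono) auto
    then show ?thesis
      using a by (intro order_trans[OF tangent[of x]] mult_left_mono) (auto simp: mult.commute)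
  qed
  show ?thesis
  proof (cases "l < 1")
    case True
    have "has_bochner_integral lborel (\<lambda>x. \<bar>x\<bar> ^ 2 * f x) 1"
      using f by (simp add: standardized_density_def)
    then have "1 \<le> 2 * 2 * (a * exp (l * 2)) + 1 / 2 ^ 2"
      by (intro mass_le_window_plus_moment[OF nonneg mass]) (auto intro: window)
    moreover have "a * exp (l * 2) \<le> a * 9"
    proof (intro mult_left_mono a)
      have "exp (l * 2) \<le> exp (1::real) ^ 2"
        using True by (simp add: exp_double[symmetric])
      also have "\<dots> \<le> 3 ^ 2"
        by (intro power_mono exp_le) auto
      finally show "exp (l * 2) \<le> 9" by simp
    qed
    ultimately show ?thesis by simp
  next
    case False
    then have l1: "1 \<le> l" by simp
    obtain I where I: "has_bochner_integral lborel (\<lambda>x. \<bar>x\<bar> * f x) I" "I \<le> 2 * a / l\<^sup>2"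
      using abs_moment_le_of_exponential_tail[OF f _ tangent] l1 by auto
    have "1 \<le> 2 * (1 / l) * (a * exp (l * (1 / l))) + I / (1 / l) ^ 1"
      using I(1) l1
      by (intro mass_le_window_plus_moment[OF nonneg mass] window) auto
    also have "\<dots> = 2 * exp 1 * a / l + I * l"
      using l1 by simp
    also have "\<dots> \<le> 2 * 3 * a / l + (2 * a / l\<^sup>2) * l"
      using I(2) l1 a exp_le
      by (intro add_mono divide_right_mono mult_right_mono mult_left_mono) auto
    also have "\<dots> = 8 * a / l"
      using l1 by (simp add: field_simps power2_eq_square)
    finally have "l \<le> 8 * a"
      using l1 by (simp add: field_simps)
    with l1 show ?thesis by simp
  qed
qed

lemma log_concave_standardized_density_ge:
  assumes lc: "log_concave_function f" and f: "standardized_density f"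
  shows "1 / 72 \<le> f 0"
proof -
  obtain c where c: "\<And>x. f x \<le> f 0 * exp (c * x)"
    using log_concave_tangent_at_0[OF lc] standardized_density_charges_left[OF f]
      standardized_density_charges_right[OF f] by metis
  show ?thesis
  proof (cases "c \<le> 0")
    case True
    then show ?thesis
      using standardized_density_exponential_bound[OF f, of "- c" "f 0"] c by simp
  next
    case False
    have "f (- x) \<le> f 0 * exp (- c * x)" for x
      using c[of "- x"] by simp
    then show ?thesis
      using False standardized_density_exponential_bound[OF standardized_density_reflect[OF f], of c]
      by simp
  qed
qed

section \<open>From densities to random variables\<close>

lemma standardized_density_of_distributed:
  assumes "prob_space M"
    and X: "distributed M lborel X (\<lambda>x. ennreal (f x))"
    and nonneg: "\<And>x. 0 \<le> f x"
    and "integrable M X" "(\<integral>\<omega>. X \<omega> \<partial>M) = 0"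
    and "integrable M (\<lambda>\<omega>. (X \<omega>)\<^sup>2)" "(\<integral>\<omega>. (X \<omega>)\<^sup>2 \<partial>M) = 1"
  shows "standardized_density f"
proof -
  interpret prob_space M by fact
  have transfer: "has_bochner_integral lborel (\<lambda>x. g x * f x) (\<integral>\<omega>. g (X \<omega>) \<partial>M)"
    if "integrable M (\<lambda>\<omega>. g (X \<omega>))" "g \<in> borel_measurable borel" for g :: "real \<Rightarrow> real"
    using that distributed_integrable[OF X, of g] distributed_integral[OF X, of g] nonneg
    by (simp add: has_bochner_integral_iff mult.commute)
  show ?thesis
    using transfer[of "\<lambda>_. 1"] transfer[of "\<lambda>x. x"] transfer[of "\<lambda>x. x\<^sup>2"] assms
    by (simp add: standardized_density_def prob_space)
qed

theorem corollary1p2: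
  fixes M :: "'a measure" and X :: "'a \<Rightarrow> real" and f :: "real \<Rightarrow> real"
  assumes "prob_space M"
    and "X \<in> class_L M"
    and "log_concave_density M X f"
  shows "f 0 \<ge> 1 / 72"
proof -
  have "log_concave_function f"
    using assms(3) by (simp add: log_concave_density_def)
  moreover have "standardized_density f"
    using assms calculation
    by (intro standardized_density_of_distributed[of M X])
      (auto simp: class_L_def log_concave_density_def log_concave_function_def)
  ultimately show ?thesis
    by (rule log_concave_standardized_density_ge)
qed

end
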